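(* Let $\mathbb{F}$ be a finite field and let $G=[g_{ij}]$ be a superregular $3\times 3$ matrix over $\mathbb{F}$. Put $$\Delta=g_{11}g_{22}g_{33}+g_{12}g_{23}g_{31}-g_{11}g_{23}g_{32}-g_{12}g_{21}g_{33}.$$ Then there exist dual unitary $2\times2$ matrices $A,B,C$ over $\mathbb{F}$ with $G=\tilde C\tilde B\tilde A$ if and only if $\Delta\neq 0$ in $\mathbb{F}$. Moreover, if $\Delta\ne 0$, then there is exactly one such triple $(A,B,C)$ of dual unitary matrices satisfying the normalization $a_{11}=a_{22}=b_{22}=1$, and it is given by \begin{align*} a_{11}&=1,\quad a_{12}=\frac{g_{12}}{g_{11}},\quad a_{21}=\frac{g_{21}g_{33}-g_{23}g_{31}}{g_{22}g_{33}-g_{23}g_{32}},\quad a_{22}=1, \\ b_{11}&=g_{11},\quad b_{12}=g_{13},\quad b_{21}=\frac{g_{11}(g_{22}g_{31}-g_{21}g_{32})}{\Delta},\quad b_{22}=1, \\ c_{11}&=\frac{(g_{11}g_{22}-g_{12}g_{21})(g_{22}g_{33}-g_{23}g_{32})}{\Delta},\quad c_{12}=g_{23}, \\ c_{21}&=\frac{(g_{11}g_{32}-g_{12}g_{31})(g_{22}g_{33}-g_{23}g_{32})}{\Delta},\quad c_{22}=g_{33}. \end{align*} In this solution all entries of $A,B,C$ are nonzero and $A,B,C$ are nonsingular.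
   Context: A matrix over a field is superregular if all of its minors (of all sizes, including the entries and the full determinant) are nonzero. For $2\times 2$ matrices $A=[a_{ij}]$, $B=[b_{ij}]$, $C=[c_{ij}]$ over $\mathbb{F}$, define the embedded $3\times3$ matrices $$\tilde A=\begin{bmatrix} a_{11} & a_{12} & 0 \\ a_{21} & a_{22} & 0 \\ 0 & 0 & 1 \end{bmatrix},\quad \tilde B=\begin{bmatrix} b_{11} & 0 & b_{12} \\ 0 & 1 & 0 \\ b_{21} & 0 & b_{22} \end{bmatrix},\quad \tilde C=\begin{bmatrix} 1 & 0 & 0 \\ 0 & c_{11} & c_{12} \\ 0 & c_{21} & c_{22} \end{bmatrix}.$$ A $2\times 2$ matrix $M=[m_{ij}]$ over $\mathbb{F}$ is called dual unitary if it is nonsingular and $m_{11}\neq0$, $m_{22}\ne 0$ (equivalently, the permutation operator $|x,y\rangle\mapsto|M(x,y)\rangle$ on two sites with local basis indexed by $\mathbb{F}$ is unitary and its partial transpose with respect to the second site is unitary as well). *)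

theory Defs
  imports "Jordan_Normal_Form.Determinant" "Jordan_Normal_Form.DL_Submatrix"
begin

text \<open>Matrix indices start at 0, so the mathematical entry \<open>m\<^sub>1\<^sub>1\<close> is \<open>M $$ (0, 0)\<close>.\<close>

definition superregular :: "'a :: field mat \<Rightarrow> bool" where
  "superregular M \<longleftrightarrow>
     (\<forall>I J. I \<subseteq> {0..<dim_row M} \<and> J \<subseteq> {0..<dim_col M} \<and> I \<noteq> {} \<and> card I = card J
        \<longrightarrow> det (submatrix M I J) \<noteq> 0)"

definition dual_unitary :: "'a :: field mat \<Rightarrow> bool" where
  "dual_unitary M \<longleftrightarrow>
     M \<in> carrier_mat 2 2 \<and> invertible_mat M \<and> M $$ (0, 0) \<noteq> 0 \<and> M $$ (1, 1) \<noteq> 0"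

definition embed_A :: "'a :: field mat \<Rightarrow> 'a mat" where
  "embed_A A = mat_of_rows_list 3
     [[A $$ (0, 0), A $$ (0, 1), 0],
      [A $$ (1, 0), A $$ (1, 1), 0],
      [0,           0,           1]]"

definition embed_B :: "'a :: field mat \<Rightarrow> 'a mat" where
  "embed_B B = mat_of_rows_list 3
     [[B $$ (0, 0), 0, B $$ (0, 1)],
      [0,           1, 0          ],
      [B $$ (1, 0), 0, B $$ (1, 1)]]"

definition embed_C :: "'a :: field mat \<Rightarrow> 'a mat" where
  "embed_C C = mat_of_rows_list 3
     [[1, 0,           0          ],
      [0, C $$ (0, 0), C $$ (0, 1)],
      [0, C $$ (1, 0), C $$ (1, 1)]]"

definition dual_unitary_factorization ::
  "'a :: field mat \<Rightarrow> 'a mat \<Rightarrow> 'a mat \<Rightarrow> 'a mat \<Rightarrow> bool" where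
  "dual_unitary_factorization G A B C \<longleftrightarrow>
     dual_unitary A \<and> dual_unitary B \<and> dual_unitary C \<and>
     G = embed_C C * embed_B B * embed_A A"

definition normalized :: "'a :: field mat \<Rightarrow> 'a mat \<Rightarrow> 'a mat \<Rightarrow> bool" where
  "normalized A B C \<longleftrightarrow> A $$ (0, 0) = 1 \<and> A $$ (1, 1) = 1 \<and> B $$ (1, 1) = 1"

end

theory Submission
  imports Defs
begin

text \<open>Write \<open>m\<close> for the minor of \<open>G\<close> on rows 2, 3 and columns 2, 3. Then
  \<open>\<Delta> = g\<^sub>1\<^sub>1 m - g\<^sub>1\<^sub>2 (g\<^sub>2\<^sub>1 g\<^sub>3\<^sub>3 - g\<^sub>2\<^sub>3 g\<^sub>3\<^sub>1)\<close>, and for \<open>G = C B A\<close> (embedded factors) the minors of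
  \<open>G\<close> occurring here factor, so that \<open>\<Delta> = b\<^sub>1\<^sub>1 b\<^sub>2\<^sub>2 det A det C\<close>, which dual unitarity makes nonzero.
  Under the normalization, the first row and the last column of \<open>G\<close> give \<open>a\<^sub>1\<^sub>2, b\<^sub>1\<^sub>1, b\<^sub>1\<^sub>2, c\<^sub>1\<^sub>2, c\<^sub>2\<^sub>2\<close>;
  moreover \<open>det C = m\<close> and \<open>det A = \<Delta> / (g\<^sub>1\<^sub>1 m)\<close>, and the remaining entries are quotients of
  \<open>2 \<times> 2\<close> minors of \<open>G\<close> by products of \<open>g\<^sub>1\<^sub>1\<close> and these determinants.\<close>

section \<open>Small determinants and invertibility\<close>

lemma det_2x2:
  fixes A :: "'a :: comm_ring_1 mat"
  assumes "A \<in> carrier_mat 2 2"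
  shows "det A = A $$ (0, 0) * A $$ (1, 1) - A $$ (0, 1) * A $$ (1, 0)"
proof -
  have "det A = (\<Sum>j<2. A $$ (0, j) * cofactor A 0 j)"
    using assms by (intro laplace_expansion_row) auto
  then show ?thesis
    using assms by (simp add: numeral_2_eq_2 cofactor_def det_single mat_delete_def)
qed

lemma det_3x3:
  fixes A :: "'a :: comm_ring_1 mat"
  assumes "A \<in> carrier_mat 3 3"
  shows "det A =
      A $$ (0, 0) * (A $$ (1, 1) * A $$ (2, 2) - A $$ (1, 2) * A $$ (2, 1))
    - A $$ (0, 1) * (A $$ (1, 0) * A $$ (2, 2) - A $$ (1, 2) * A $$ (2, 0))
    + A $$ (0, 2) * (A $$ (1, 0) * A $$ (2, 1) - A $$ (1, 1) * A $$ (2, 0))"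
proof -
  have *: "det A = (\<Sum>j<3. A $$ (0, j) * cofactor A 0 j)"
    using assms by (intro laplace_expansion_row) auto
  have "mat_delete A 0 j \<in> carrier_mat 2 2" for j
    using mat_delete_carrier[OF assms] by simp
  note minor = det_2x2[OF this]
  show ?thesis
    unfolding * using assms
    by (simp add: numeral_3_eq_3 numeral_2_eq_2 cofactor_def minor[unfolded numeral_2_eq_2])
      (simp add: mat_delete_def algebra_simps)
qed

lemma invertible_mat_iff_det:
  fixes A :: "'a :: field mat"
  assumes A: "A \<in> carrier_mat n n"
  shows "invertible_mat A \<longleftrightarrow> det A \<noteq> 0"
proof
  assume "invertible_mat A"
  then obtain B where AB: "A * B = 1\<^sub>m n" and BA: "B * A = 1\<^sub>m (dim_row B)"
    using A unfolding invertible_mat_def inverts_mat_def by auto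
  \<comment> \<open>\<open>invertible_mat\<close> does not fix the size of the inverse; it is read
    off from the column counts on both sides of the two equations.\<close>
  from arg_cong[OF AB, of dim_col] arg_cong[OF BA, of dim_col] A have "B \<in> carrier_mat n n"
    by auto
  from det_mult[OF A this] AB show "det A \<noteq> 0"
    by auto
next
  assume "det A \<noteq> 0"
  \<comment> \<open>A nonzero determinant makes \<open>A\<close> a unit of the ring of
    \<open>n\<close> by \<open>n\<close> matrices; \<open>()\<close> only fills the record-extension
    slot of that ring.\<close>
  from det_non_zero_imp_unit[OF A this, of "()"]
  obtain B where "B \<in> carrier_mat n n" "A * B = 1\<^sub>m n" "B * A = 1\<^sub>m n"
    by (auto simp: Units_def ring_mat_def)
  then show "invertible_mat A"
    using A unfolding invertible_mat_def inverts_mat_def by auto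
qed

section \<open>Nonvanishing minors of a superregular matrix\<close>

lemma pick_singleton: "pick {i} 0 = i"
  by (auto intro: Least_equality)

text \<open>\<open>pick S n\<close> is the \<open>n\<close>-th smallest element of \<open>S\<close>,
  counted from 0, so \<open>i < k\<close> puts \<open>i\<close> first. This settles which entry of
  \<open>M\<close> stands where in a 2 by 2 submatrix.\<close>

lemma pick_pair:
  assumes "i < k"
  shows "pick {i, k} 0 = i" "pick {i, k} (Suc 0) = k"
proof -
  show "pick {i, k} 0 = i"
    using assms by (auto intro!: Least_equality)
  then show "pick {i, k} (Suc 0) = k"
    using assms by (auto simp del: pick.simps(1) intro!: Least_equality)
qed

lemma superregular_entry_nz:
  assumes "superregular M" "i < dim_row M" "j < dim_col M"
  shows "M $$ (i, j) \<noteq> 0"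
proof -
  let ?S = "submatrix M {i} {j}"
  have sets: "{a. a < dim_row M \<and> a \<in> {i}} = {i}" "{a. a < dim_col M \<and> a \<in> {j}} = {j}"
    using assms by auto
  have "?S \<in> carrier_mat 1 1"
    unfolding submatrix_def sets by simp
  moreover have "?S $$ (0, 0) = M $$ (i, j)"
    unfolding submatrix_def sets by (simp add: pick_singleton del: pick.simps)
  moreover have "det ?S \<noteq> 0"
    using assms unfolding superregular_def by auto
  ultimately show ?thesis
    by (simp add: det_single)
qed

lemma superregular_minor_nz:
  assumes "superregular M" "i < k" "k < dim_row M" "j < l" "l < dim_col M"
  shows "M $$ (i, j) * M $$ (k, l) - M $$ (i, l) * M $$ (k, j) \<noteq> 0"
proof -
  let ?S = "submatrix M {i, k} {j, l}"
  have sets: "{a. a < dim_row M \<and> a \<in> {i, k}} = {i, k}"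
      "{a. a < dim_col M \<and> a \<in> {j, l}} = {j, l}"
    and card: "card {i, k} = 2" "card {j, l} = 2"
    using assms by auto
  have "?S \<in> carrier_mat 2 2"
    unfolding submatrix_def sets card by simp
  moreover have "?S $$ (a, b) = M $$ (pick {i, k} a, pick {j, l} b)" if "a < 2" "b < 2" for a b
    unfolding submatrix_def sets card using that by simp
  moreover have "det ?S \<noteq> 0"
    using assms card unfolding superregular_def by auto
  ultimately show ?thesis
    using assms by (simp add: det_2x2 pick_pair del: pick.simps)
qed

text \<open>Entry \<open>(i, j)\<close> moves to the position given by the numbers of selected
  indices below \<open>i\<close> and below \<open>j\<close>; when all indices are selected, these
  numbers are \<open>i\<close> and \<open>j\<close> again.\<close>

lemma submatrix_full: "submatrix M {0..<dim_row M} {0..<dim_col M} = M"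
proof (rule eq_matI)
  fix i j assume ij: "i < dim_row M" "j < dim_col M"
  have "{a \<in> {0..<dim_row M}. a < i} = {0..<i}" "{a \<in> {0..<dim_col M}. a < j} = {0..<j}"
    using ij by auto
  then show "submatrix M {0..<dim_row M} {0..<dim_col M} $$ (i, j) = M $$ (i, j)"
    using submatrix_index_card[of i M j "{0..<dim_row M}" "{0..<dim_col M}"] ij by simp
qed (auto simp: dim_submatrix)

lemma superregular_det_nz:
  assumes "superregular M" "M \<in> carrier_mat n n" "n > 0"
  shows "det M \<noteq> 0"
proof -
  have "det (submatrix M {0..<dim_row M} {0..<dim_col M}) \<noteq> 0"
    using assms unfolding superregular_def by auto
  then show ?thesis
    by (simp add: submatrix_full)
qed

section \<open>Explicit matrices, dual unitarity and the embedded product\<close>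

lemma mat_of_rows_list_2x2_index:
  "mat_of_rows_list 2 [[a, b], [c, d]] \<in> carrier_mat 2 2"
  "mat_of_rows_list 2 [[a, b], [c, d]] $$ (0, 0) = a"
  "mat_of_rows_list 2 [[a, b], [c, d]] $$ (0, 1) = b"
  "mat_of_rows_list 2 [[a, b], [c, d]] $$ (1, 0) = c"
  "mat_of_rows_list 2 [[a, b], [c, d]] $$ (1, 1) = d"
  by (auto simp: mat_of_rows_list_def)

lemma mat_2x2_eq_iff:
  assumes "A \<in> carrier_mat 2 2"
  shows "A = mat_of_rows_list 2 [[a, b], [c, d]] \<longleftrightarrow>
    A $$ (0, 0) = a \<and> A $$ (0, 1) = b \<and> A $$ (1, 0) = c \<and> A $$ (1, 1) = d"
  using assms
  by (auto simp: mat_of_rows_list_2x2_index[unfolded One_nat_def] mat_of_rows_list_def less_Suc_eq less_2_cases_iff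
      intro!: eq_matI)

lemma mat_of_rows_list_3x3_index:
  "mat_of_rows_list 3 [[a, b, c], [d, e, f], [g, h, k]] \<in> carrier_mat 3 3"
  "mat_of_rows_list 3 [[a, b, c], [d, e, f], [g, h, k]] $$ (0, 0) = a"
  "mat_of_rows_list 3 [[a, b, c], [d, e, f], [g, h, k]] $$ (0, 1) = b"
  "mat_of_rows_list 3 [[a, b, c], [d, e, f], [g, h, k]] $$ (0, 2) = c"
  "mat_of_rows_list 3 [[a, b, c], [d, e, f], [g, h, k]] $$ (1, 0) = d"
  "mat_of_rows_list 3 [[a, b, c], [d, e, f], [g, h, k]] $$ (1, 1) = e"
  "mat_of_rows_list 3 [[a, b, c], [d, e, f], [g, h, k]] $$ (1, 2) = f"
  "mat_of_rows_list 3 [[a, b, c], [d, e, f], [g, h, k]] $$ (2, 0) = g"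
  "mat_of_rows_list 3 [[a, b, c], [d, e, f], [g, h, k]] $$ (2, 1) = h"
  "mat_of_rows_list 3 [[a, b, c], [d, e, f], [g, h, k]] $$ (2, 2) = k"
  by (auto simp: mat_of_rows_list_def)

text \<open>This splits a factorization of \<open>G\<close> into nine scalar equations.\<close>

lemma mat_of_rows_list_3x3_eq_iff:
  "mat_of_rows_list 3 [[a, b, c], [d, e, f], [g, h, k]]
    = mat_of_rows_list 3 [[a', b', c'], [d', e', f'], [g', h', k']] \<longleftrightarrow>
   a = a' \<and> b = b' \<and> c = c' \<and> d = d' \<and> e = e' \<and> f = f' \<and> g = g' \<and> h = h' \<and> k = k'"
  by (metis mat_of_rows_list_3x3_index)

lemma mat_of_rows_list_3x3_mult:
  fixes a :: "'a :: semiring_0"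
  shows "mat_of_rows_list 3 [[a, b, c], [d, e, f], [g, h, k]]
    * mat_of_rows_list 3 [[a', b', c'], [d', e', f'], [g', h', k']] =
   mat_of_rows_list 3
    [[a * a' + b * d' + c * g', a * b' + b * e' + c * h', a * c' + b * f' + c * k'],
     [d * a' + e * d' + f * g', d * b' + e * e' + f * h', d * c' + e * f' + f * k'],
     [g * a' + h * d' + k * g', g * b' + h * e' + k * h', g * c' + h * f' + k * k']]"
  by (rule eq_matI)
    (auto simp: mat_of_rows_list_def scalar_prod_def numeral_3_eq_3 less_Suc_eq add.assoc)

lemma dual_unitary_iff:
  "dual_unitary M \<longleftrightarrow> M \<in> carrier_mat 2 2 \<and>
     M $$ (0, 0) * M $$ (1, 1) - M $$ (0, 1) * M $$ (1, 0) \<noteq> 0 \<and>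
     M $$ (0, 0) \<noteq> 0 \<and> M $$ (1, 1) \<noteq> 0"
  unfolding dual_unitary_def by (metis invertible_mat_iff_det det_2x2)

lemma embedded_product:
  fixes A B C :: "'a :: field mat"
  shows "embed_C C * embed_B B * embed_A A = mat_of_rows_list 3
    [[B $$ (0, 0) * A $$ (0, 0), B $$ (0, 0) * A $$ (0, 1), B $$ (0, 1)],
     [C $$ (0, 0) * A $$ (1, 0) + C $$ (0, 1) * B $$ (1, 0) * A $$ (0, 0),
      C $$ (0, 0) * A $$ (1, 1) + C $$ (0, 1) * B $$ (1, 0) * A $$ (0, 1),
      C $$ (0, 1) * B $$ (1, 1)],
     [C $$ (1, 0) * A $$ (1, 0) + C $$ (1, 1) * B $$ (1, 0) * A $$ (0, 0),
      C $$ (1, 0) * A $$ (1, 1) + C $$ (1, 1) * B $$ (1, 0) * A $$ (0, 1),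
      C $$ (1, 1) * B $$ (1, 1)]]"
  unfolding embed_A_def embed_B_def embed_C_def mat_of_rows_list_3x3_mult
  by (simp add: add.commute)

theorem mainTheorem1:
  fixes G :: "'a :: {field, finite} mat"
    and g11 g12 g13 g21 g22 g23 g31 g32 g33 \<Delta> :: 'a
  assumes G: "G = mat_of_rows_list 3
                [[g11, g12, g13],
                 [g21, g22, g23],
                 [g31, g32, g33]]"
    and superregular: "superregular G"
    and Delta: "\<Delta> = g11 * g22 * g33 + g12 * g23 * g31 - g11 * g23 * g32 - g12 * g21 * g33"
  shows "((\<exists>A B C. dual_unitary_factorization G A B C) \<longleftrightarrow> \<Delta> \<noteq> 0) \<and>
    (\<Delta> \<noteq> 0 \<longrightarrow>
      (\<exists>!(A, B, C). dual_unitary_factorization G A B C \<and> normalized A B C) \<and>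
      (let a11 = 1;
           a12 = g12 / g11;
           a21 = (g21 * g33 - g23 * g31) / (g22 * g33 - g23 * g32);
           a22 = 1;
           b11 = g11;
           b12 = g13;
           b21 = g11 * (g22 * g31 - g21 * g32) / \<Delta>;
           b22 = 1;
           c11 = (g11 * g22 - g12 * g21) * (g22 * g33 - g23 * g32) / \<Delta>;
           c12 = g23;
           c21 = (g11 * g32 - g12 * g31) * (g22 * g33 - g23 * g32) / \<Delta>;
           c22 = g33;
           A = mat_of_rows_list 2 [[a11, a12], [a21, a22]];
           B = mat_of_rows_list 2 [[b11, b12], [b21, b22]];
           C = mat_of_rows_list 2 [[c11, c12], [c21, c22]]
       in dual_unitary_factorization G A B C \<and> normalized A B C \<and>
          (\<forall>i<2. \<forall>j<2. A $$ (i, j) \<noteq> 0 \<and> B $$ (i, j) \<noteq> 0 \<and> C $$ (i, j) \<noteq> 0) \<and>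
          invertible_mat A \<and> invertible_mat B \<and> invertible_mat C))"
proof -
  let ?m = "g22 * g33 - g23 * g32"
  have Gc: "G \<in> carrier_mat 3 3"
    unfolding G by (rule mat_of_rows_list_3x3_index)
  then have dim: "dim_row G = 3" "dim_col G = 3"
    by auto
  note G_index = mat_of_rows_list_3x3_index[of g11 g12 g13 g21 g22 g23 g31 g32 g33, folded G]
  have entries: "g11 \<noteq> 0" "g12 \<noteq> 0" "g13 \<noteq> 0" "g23 \<noteq> 0" "g33 \<noteq> 0"
    using superregular_entry_nz[OF superregular, of 0 0] superregular_entry_nz[OF superregular, of 0 1]
      superregular_entry_nz[OF superregular, of 0 2] superregular_entry_nz[OF superregular, of 1 2]
      superregular_entry_nz[OF superregular, of 2 2]
    unfolding dim G_index by simp_all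
  have minors: "g11 * g22 - g12 * g21 \<noteq> 0" "g11 * g32 - g12 * g31 \<noteq> 0"
      "g21 * g32 - g22 * g31 \<noteq> 0" "g21 * g33 - g23 * g31 \<noteq> 0" "?m \<noteq> 0"
    using superregular_minor_nz[OF superregular, of 0 1 0 1]
      superregular_minor_nz[OF superregular, of 0 2 0 1]
      superregular_minor_nz[OF superregular, of 1 2 0 1]
      superregular_minor_nz[OF superregular, of 1 2 0 2]
      superregular_minor_nz[OF superregular, of 1 2 1 2]
    unfolding dim G_index by simp_all
  \<comment> \<open>The expansion along the first row is \<Delta> plus a term in \<open>g13\<close>;
    it will give the nonsingularity of \<open>B0\<close>.\<close>
  have detG: "g11 * ?m - g12 * (g21 * g33 - g23 * g31) + g13 * (g21 * g32 - g22 * g31) \<noteq> 0"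
    using superregular_det_nz[OF superregular Gc] unfolding det_3x3[OF Gc] G_index by simp
  have Delta': "\<Delta> = g11 * ?m - g12 * (g21 * g33 - g23 * g31)"
    unfolding Delta by (simp add: algebra_simps)

  \<comment> \<open>Necessity of \<Delta> \<noteq> 0\<close>
  have necessary: "\<Delta> \<noteq> 0" if "dual_unitary_factorization G A B C" for A B C
  proof -
    \<comment> \<open>All terms with \<open>B $$ (1, 0)\<close> cancel, since they add to columns 1
      and 2 of \<open>G\<close> multiples of the last column of \<open>C\<close>, to which column 3
      is proportional in rows 2 and 3.\<close>
    from that have "\<Delta> = B $$ (0, 0) * B $$ (1, 1)
        * (A $$ (0, 0) * A $$ (1, 1) - A $$ (0, 1) * A $$ (1, 0))
        * (C $$ (0, 0) * C $$ (1, 1) - C $$ (0, 1) * C $$ (1, 0))"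
      unfolding dual_unitary_factorization_def embedded_product G mat_of_rows_list_3x3_eq_iff Delta
      by (elim conjE) (simp add: algebra_simps)
    with that show ?thesis
      by (simp add: dual_unitary_factorization_def dual_unitary_iff)
  qed

  define a12 where "a12 = g12 / g11"
  define a21 where "a21 = (g21 * g33 - g23 * g31) / ?m"
  define b21 where "b21 = g11 * (g22 * g31 - g21 * g32) / \<Delta>"
  define c11 where "c11 = (g11 * g22 - g12 * g21) * ?m / \<Delta>"
  define c21 where "c21 = (g11 * g32 - g12 * g31) * ?m / \<Delta>"
  define A0 where "A0 = mat_of_rows_list 2 [[1, a12], [a21, 1]]"
  define B0 where "B0 = mat_of_rows_list 2 [[g11, g13], [b21, 1]]"
  define C0 where "C0 = mat_of_rows_list 2 [[c11, g23], [c21, g33]]"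
  note defs = a12_def a21_def b21_def c11_def c21_def
  note index0 = mat_of_rows_list_2x2_index[of 1 a12 a21 1, folded A0_def]
    mat_of_rows_list_2x2_index[of g11 g13 b21 1, folded B0_def]
    mat_of_rows_list_2x2_index[of c11 g23 c21 g33, folded C0_def]

  \<comment> \<open>Uniqueness of the normalized factorization\<close>
  have unique: "A = A0 \<and> B = B0 \<and> C = C0"
    if fac: "dual_unitary_factorization G A B C" and norm: "normalized A B C" for A B C
  proof -
    have carrier: "A \<in> carrier_mat 2 2" "B \<in> carrier_mat 2 2" "C \<in> carrier_mat 2 2"
      using fac by (auto simp: dual_unitary_factorization_def dual_unitary_def)
    note nz = necessary[OF fac]
    \<comment> \<open>Five unknowns remain once the normalization, the first row and the last column
      of \<open>G\<close> have fixed the other entries.\<close>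
    define x y where "x = A $$ (0, 1)" and "y = A $$ (1, 0)"
    define u v w where "u = B $$ (1, 0)" and "v = C $$ (0, 0)" and "w = C $$ (1, 0)"
    have n: "A $$ (0, 0) = 1" "A $$ (1, 1) = 1" "B $$ (1, 1) = 1"
      using norm by (auto simp: normalized_def)
    have e: "B $$ (0, 0) = g11" "B $$ (0, 1) = g13" "C $$ (0, 1) = g23" "C $$ (1, 1) = g33"
      and e12: "g12 = g11 * x"
      and e21: "g21 = v * y + g23 * u" and e22: "g22 = v + g23 * u * x"
      and e31: "g31 = w * y + g33 * u" and e32: "g32 = w + g33 * u * x"
      using fac n unfolding dual_unitary_factorization_def embedded_product G
        mat_of_rows_list_3x3_eq_iff x_def y_def u_def v_def w_def by auto
    have m: "?m = v * g33 - g23 * w"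
      unfolding e22 e32 by (simp add: algebra_simps)
    have D: "\<Delta> = g11 * ?m * (1 - x * y)"
      unfolding Delta e12 e21 e22 e31 e32 by (simp add: algebra_simps)
    have "x = a12"
      using e12 entries by (simp add: a12_def)
    moreover have "y * ?m = g21 * g33 - g23 * g31"
      unfolding e21 e22 e31 e32 by (simp add: algebra_simps)
    then have "y = a21"
      using minors by (simp add: a21_def eq_divide_eq)
    \<comment> \<open>The minors of \<open>G\<close> on columns 1 and 2 all carry the factor
      \<open>1 - x * y\<close>: the other factor is \<open>g11 * v\<close>, \<open>g11 * w\<close>
      or, up to sign, \<open>u * ?m\<close>. By \<open>D\<close>, the missing factors complete each
      to a multiple of \<Delta>.\<close>
    moreover have "u * \<Delta> = g11 * (g22 * g31 - g21 * g32)"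
      unfolding D m unfolding e21 e22 e31 e32 by (simp add: algebra_simps)
    then have "u = b21"
      using nz by (simp add: b21_def eq_divide_eq)
    moreover have "v * \<Delta> = (g11 * g22 - g12 * g21) * ?m"
      unfolding D m unfolding e12 e21 e22 by (simp add: algebra_simps)
    then have "v = c11"
      using nz by (simp add: c11_def eq_divide_eq)
    moreover have "w * \<Delta> = (g11 * g32 - g12 * g31) * ?m"
      unfolding D m unfolding e12 e31 e32 by (simp add: algebra_simps)
    then have "w = c21"
      using nz by (simp add: c21_def eq_divide_eq)
    ultimately show ?thesis
      unfolding A0_def B0_def C0_def mat_2x2_eq_iff[OF carrier(1)] mat_2x2_eq_iff[OF carrier(2)]
        mat_2x2_eq_iff[OF carrier(3)]
      using n e by (simp add: x_def y_def u_def v_def w_def)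
  qed

  \<comment> \<open>Existence by the closed formulas\<close>
  have solution: "dual_unitary_factorization G A0 B0 C0 \<and> normalized A0 B0 C0 \<and>
      (\<forall>i<2. \<forall>j<2. A0 $$ (i, j) \<noteq> 0 \<and> B0 $$ (i, j) \<noteq> 0 \<and> C0 $$ (i, j) \<noteq> 0) \<and>
      invertible_mat A0 \<and> invertible_mat B0 \<and> invertible_mat C0"
    if nz: "\<Delta> \<noteq> 0"
  proof -
    \<comment> \<open>Up to sign, each numerator is a product of entries and 2 by 2 minors of
      \<open>G\<close>.\<close>
    have nz_entries: "a12 \<noteq> 0" "a21 \<noteq> 0" "b21 \<noteq> 0" "c11 \<noteq> 0" "c21 \<noteq> 0"
      using entries minors nz by (simp_all add: defs)
    have xa: "a12 * g11 = g12" "a21 * ?m = g21 * g33 - g23 * g31"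
      and xb: "b21 * \<Delta> = g11 * (g22 * g31 - g21 * g32)"
      and xc: "c11 * \<Delta> = (g11 * g22 - g12 * g21) * ?m" "c21 * \<Delta> = (g11 * g32 - g12 * g31) * ?m"
      using entries minors nz by (simp_all add: defs)
    have "(1 - a12 * a21) * (g11 * ?m) = g11 * ?m - (a12 * g11) * (a21 * ?m)"
      by (simp add: algebra_simps)
    also have "\<dots> = \<Delta>"
      unfolding xa Delta' ..
    finally have dA: "1 - a12 * a21 \<noteq> 0"
      using nz by auto
    \<comment> \<open>The determinant of \<open>B0\<close> times \<Delta> is
      \<open>g11 * det G\<close>; here the full determinant of \<open>G\<close> enters.\<close>
    have "(g11 - g13 * b21) * \<Delta> = g11 * \<Delta> - g13 * (b21 * \<Delta>)"
      by (simp add: algebra_simps)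
    also have "\<dots> = g11 * (g11 * ?m - g12 * (g21 * g33 - g23 * g31) + g13 * (g21 * g32 - g22 * g31))"
      unfolding xa xb xc unfolding Delta by (simp add: algebra_simps)
    finally have dB: "g11 - g13 * b21 \<noteq> 0"
      using detG entries by auto
    have "(c11 * g33 - g23 * c21) * \<Delta> = g33 * (c11 * \<Delta>) - g23 * (c21 * \<Delta>)"
      by (simp add: algebra_simps)
    also have "\<dots> = ?m * \<Delta>"
      unfolding xa xb xc unfolding Delta by (simp add: algebra_simps)
    finally have dC: "c11 * g33 - g23 * c21 \<noteq> 0"
      using nz minors by auto
    have du: "dual_unitary A0" "dual_unitary B0" "dual_unitary C0"
      using dA dB dC nz_entries entries unfolding dual_unitary_iff index0
      by (simp_all add: index0(1,6,11))

    \<comment> \<open>The four product entries that involve \<open>b21\<close> are checked after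
      multiplication by \<Delta> and by \<open>g11\<close> or \<open>?m\<close>. The factors are
      grouped so that \<open>xa\<close>, \<open>xb\<close> and \<open>xc\<close> remove every
      quotient, leaving a polynomial identity in the entries of \<open>G\<close>.\<close>
    have "(c11 + g23 * b21 * a12) * (\<Delta> * g11) = (c11 * \<Delta>) * g11 + g23 * (b21 * \<Delta>) * (a12 * g11)"
      by (simp add: algebra_simps)
    also have "\<dots> = g22 * (\<Delta> * g11)"
      unfolding xa xb xc unfolding Delta by (simp add: algebra_simps)
    finally have p22: "g22 = c11 + g23 * b21 * a12"
      using nz entries by simp
    have "(c21 + g33 * b21 * a12) * (\<Delta> * g11) = (c21 * \<Delta>) * g11 + g33 * (b21 * \<Delta>) * (a12 * g11)"
      by (simp add: algebra_simps)
    also have "\<dots> = g32 * (\<Delta> * g11)"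
      unfolding xa xb xc unfolding Delta by (simp add: algebra_simps)
    finally have p32: "g32 = c21 + g33 * b21 * a12"
      using nz entries by simp
    have "(c11 * a21 + g23 * b21) * (\<Delta> * ?m) = (c11 * \<Delta>) * (a21 * ?m) + g23 * (b21 * \<Delta>) * ?m"
      by (simp add: algebra_simps)
    also have "\<dots> = g21 * (\<Delta> * ?m)"
      unfolding xa xb xc unfolding Delta by (simp add: algebra_simps)
    finally have p21: "g21 = c11 * a21 + g23 * b21"
      using nz minors by (metis mult_eq_0_iff mult_right_cancel)
    have "(c21 * a21 + g33 * b21) * (\<Delta> * ?m) = (c21 * \<Delta>) * (a21 * ?m) + g33 * (b21 * \<Delta>) * ?m"
      by (simp add: algebra_simps)
    also have "\<dots> = g31 * (\<Delta> * ?m)"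
      unfolding xa xb xc unfolding Delta by (simp add: algebra_simps)
    finally have p31: "g31 = c21 * a21 + g33 * b21"
      using nz minors by (metis mult_eq_0_iff mult_right_cancel)
    have "G = embed_C C0 * embed_B B0 * embed_A A0"
      unfolding embedded_product index0 G mat_of_rows_list_3x3_eq_iff
      using p21 p22 p31 p32 xa by (simp add: mult.commute)
    with du have "dual_unitary_factorization G A0 B0 C0"
      by (simp add: dual_unitary_factorization_def)
    moreover have "normalized A0 B0 C0"
      unfolding normalized_def index0 by simp
    moreover have "\<forall>i<2. \<forall>j<2. A0 $$ (i, j) \<noteq> 0 \<and> B0 $$ (i, j) \<noteq> 0 \<and> C0 $$ (i, j) \<noteq> 0"
      using nz_entries entries by (auto simp: less_2_cases_iff index0[unfolded One_nat_def])
    ultimately show ?thesis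
      using du by (simp add: dual_unitary_def)
  qed

  have "\<exists>!(A, B, C). dual_unitary_factorization G A B C \<and> normalized A B C" if "\<Delta> \<noteq> 0"
  proof (rule ex1I[of _ "(A0, B0, C0)"])
    show "case (A0, B0, C0) of (A, B, C) \<Rightarrow> dual_unitary_factorization G A B C \<and> normalized A B C"
      using solution[OF that] by simp
  qed (use unique in auto)
  then show ?thesis
    unfolding Let_def
    using necessary solution
    \<comment> \<open>With the names unfolded, \<open>solution\<close> speaks of the quotients
      written in the \<open>let\<close>.\<close>
    unfolding A0_def B0_def C0_def defs by blast
qed

end
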